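(* Let $\lambda>0$. There exist $c_1\in\mathbb{R}$ and a smooth regular closed curve $\gamma\colon\mathbb{S}^1\to\mathbb{R}^2$ satisfying $$\nabla_s^2\kappa+\tfrac12|\kappa|^2\kappa-\lambda\kappa=c_1\nu$$ such that $\gamma$ describes neither a multifold covered circle nor a multifold covered figure eight elastica.
   Context: For a regular curve $\gamma\colon\mathbb{S}^1\to\mathbb{R}^2$ ($\partial_x\gamma\ne0$): $\partial_s=|\partial_x\gamma|^{-1}\partial_x$, $\kappa=\partial_s^2\gamma$ is the curvature vector, $\nu$ is the counter-clockwise rotation of $\partial_s\gamma$ by $\pi/2$, and $\nabla_s\phi=\partial_s\phi-\langle\partial_s\phi,\partial_s\gamma\rangle\partial_s\gamma$ for vector fields $\phi$ along $\gamma$. An elastica is a curve satisfying $\nabla_s^2\kappa+\frac12|\kappa|^2\kappa-\mu\kappa=0$ for some $\mu$. It is known that the only closed planar elasticae are multifold coverings ($m$-fold, $m\ge1$) of a circle and of the figure eight elastica, the latter being (up to isometry, scaling and reparametrization) the unique once-covered non-circular closed planar elastica; it has rotation index $\frac{1}{2\pi}\int\langle\kappa,\nu\rangle\,\mathrm{d}s=0$ and signed enclosed area $-\frac12\int\langle\gamma,\nu\rangle\,\mathrm{d}s=0$. *)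

theory Defs
  imports "HOL-Analysis.Analysis"
begin

text \<open>
  The circle is taken as the reals modulo 1: a map on it is a 1-periodic function on the reals,
  and a self-diffeomorphism of it is given by a lift to the reals.
\<close>

text \<open>All iterated derivatives exist everywhere.\<close>

definition smooth :: "(real \<Rightarrow> 'a::real_normed_vector) \<Rightarrow> bool" where
  "smooth f \<longleftrightarrow>
     (\<forall>n x. ((\<lambda>g t. vector_derivative g (at t)) ^^ n) f differentiable (at x))"

definition regular_closed_curve :: "(real \<Rightarrow> real^2) \<Rightarrow> bool" where
  "regular_closed_curve \<gamma> \<longleftrightarrow>
     smooth \<gamma> \<and> (\<forall>x. \<gamma> (x + 1) = \<gamma> x) \<and> (\<forall>x. vector_derivative \<gamma> (at x) \<noteq> 0)"

definition arc_deriv :: "(real \<Rightarrow> real^2) \<Rightarrow> (real \<Rightarrow> real^2) \<Rightarrow> real \<Rightarrow> real^2" where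
  "arc_deriv \<gamma> \<phi> x =
     (1 / norm (vector_derivative \<gamma> (at x))) *\<^sub>R vector_derivative \<phi> (at x)"

definition tangent :: "(real \<Rightarrow> real^2) \<Rightarrow> real \<Rightarrow> real^2" where
  "tangent \<gamma> = arc_deriv \<gamma> \<gamma>"

definition curvature :: "(real \<Rightarrow> real^2) \<Rightarrow> real \<Rightarrow> real^2" where
  "curvature \<gamma> = arc_deriv \<gamma> (arc_deriv \<gamma> \<gamma>)"

definition unit_normal :: "(real \<Rightarrow> real^2) \<Rightarrow> real \<Rightarrow> real^2" where
  "unit_normal \<gamma> x = vector [- (tangent \<gamma> x $ 2), tangent \<gamma> x $ 1]"

definition normal_deriv :: "(real \<Rightarrow> real^2) \<Rightarrow> (real \<Rightarrow> real^2) \<Rightarrow> real \<Rightarrow> real^2" where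
  "normal_deriv \<gamma> \<phi> x =
     arc_deriv \<gamma> \<phi> x - (arc_deriv \<gamma> \<phi> x \<bullet> tangent \<gamma> x) *\<^sub>R tangent \<gamma> x"

definition elastic_operator :: "real \<Rightarrow> (real \<Rightarrow> real^2) \<Rightarrow> real \<Rightarrow> real^2" where
  "elastic_operator \<mu> \<gamma> x =
     normal_deriv \<gamma> (normal_deriv \<gamma> (curvature \<gamma>)) x
       + ((1/2) * (norm (curvature \<gamma> x))\<^sup>2) *\<^sub>R curvature \<gamma> x
       - \<mu> *\<^sub>R curvature \<gamma> x"

definition closed_elastica :: "(real \<Rightarrow> real^2) \<Rightarrow> bool" where
  "closed_elastica \<gamma> \<longleftrightarrow>
     regular_closed_curve \<gamma> \<and> (\<exists>\<mu>. \<forall>x. elastic_operator \<mu> \<gamma> x = 0)"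

text \<open>
  Lifts of diffeomorphisms of the circle, orientation preserving or reversing. The conditions
  make \<open>\<phi>\<close> a bijection of the reals, with smooth inverse.
\<close>

definition circle_reparametrization :: "(real \<Rightarrow> real) \<Rightarrow> bool" where
  "circle_reparametrization \<phi> \<longleftrightarrow>
     smooth \<phi> \<and> (\<forall>x. vector_derivative \<phi> (at x) \<noteq> 0)
     \<and> ((\<forall>x. \<phi> (x + 1) = \<phi> x + 1) \<or> (\<forall>x. \<phi> (x + 1) = \<phi> x - 1))"

text \<open>Up to reparametrization, \<open>\<gamma>\<close> runs \<open>m\<close> times through \<open>\<eta>\<close>.\<close>

definition fold_cover :: "nat \<Rightarrow> (real \<Rightarrow> real^2) \<Rightarrow> (real \<Rightarrow> real^2) \<Rightarrow> bool" where
  "fold_cover m \<eta> \<gamma> \<longleftrightarrow>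
     (\<exists>\<phi>. circle_reparametrization \<phi> \<and> (\<forall>x. \<gamma> x = \<eta> (real m * \<phi> x)))"

definition once_covered :: "(real \<Rightarrow> real^2) \<Rightarrow> bool" where
  "once_covered \<gamma> \<longleftrightarrow>
     \<not> (\<exists>m \<eta>. 2 \<le> m \<and> regular_closed_curve \<eta> \<and> fold_cover m \<eta> \<gamma>)"

definition circle_curve :: "real^2 \<Rightarrow> real \<Rightarrow> real \<Rightarrow> real^2" where
  "circle_curve p r x = p + r *\<^sub>R vector [cos (2 * pi * x), sin (2 * pi * x)]"

definition multifold_circle :: "(real \<Rightarrow> real^2) \<Rightarrow> bool" where
  "multifold_circle \<gamma> \<longleftrightarrow>
     (\<exists>m p r. 1 \<le> m \<and> 0 < r \<and> fold_cover m (circle_curve p r) \<gamma>)"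

text \<open>
  The figure eight elastica is, up to isometry, scaling and reparametrization, the unique
  once-covered non-circular closed planar elastica; the predicate describes all its copies.
\<close>

definition figure_eight_elastica :: "(real \<Rightarrow> real^2) \<Rightarrow> bool" where
  "figure_eight_elastica \<eta> \<longleftrightarrow>
     closed_elastica \<eta> \<and> once_covered \<eta> \<and> \<not> multifold_circle \<eta>"

definition multifold_figure_eight :: "(real \<Rightarrow> real^2) \<Rightarrow> bool" where
  "multifold_figure_eight \<gamma> \<longleftrightarrow>
     (\<exists>m \<eta>. 1 \<le> m \<and> figure_eight_elastica \<eta> \<and> fold_cover m \<eta> \<gamma>)"

end

theory Submission
  imports Defs
begin

text \<open>
  With signed curvature \<open>k\<close> the equation reads \<open>k'' + k\<^sup>3/2 - \<lambda>k = c\<close>, with first integral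
  \<open>k'\<^sup>2 = -k\<^sup>4/4 + \<lambda>k\<^sup>2 + 2ck + E\<close>. If the quartic has a double root outside the interval
  between its two simple roots, the solution is a rational function of a cosine. With
  \<open>w = \<surd>(\<lambda>/5)\<close>, \<open>\<phi> = ws\<close> and \<open>r = 1/(2 + \<surd>3 cos \<phi>)\<close>, the choice \<open>k = 2w(r - 1)\<close>, \<open>c = 6w\<^sup>3\<close>
  has total curvature \<open>0\<close> over one period, so that the tangent is periodic. For \<open>c \<noteq> 0\<close> the
  curve itself is then periodic too: in complex notation \<open>((k\<^sup>2/2 - \<lambda>) + ik')T\<close> has derivative
  \<open>icT\<close>, hence is \<open>ic\<gamma>\<close> up to a constant.

  The elastic operator is invariant under reparametrization, so a multiple cover of a circle or
  of the figure eight elastica would satisfy the equation also with right hand side \<open>0\<close> and some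
  \<open>\<mu>\<close> in place of \<open>\<lambda>\<close>. Then \<open>(\<mu> - \<lambda>)k = c \<noteq> 0\<close>, but \<open>k\<close> is not constant.
\<close>

section \<open>Coordinates in the plane\<close>

lemma vector2_eq: "(vector [a, b] :: real^2) = a *\<^sub>R axis 1 1 + b *\<^sub>R axis 2 1"
  by (simp add: vec_eq_iff forall_2 axis_def)

lemma has_vector_derivative_vector2:
  assumes "(f has_real_derivative f') (at x)" "(g has_real_derivative g') (at x)"
  shows "((\<lambda>x. vector [f x, g x] :: real^2) has_vector_derivative vector [f', g']) (at x)"
  unfolding vector2_eq
  using assms by (auto intro!: derivative_eq_intros simp: has_real_derivative_iff_has_vector_derivative)

lemma inner_vector2: "(vector [a, b] :: real^2) \<bullet> vector [c, d] = a * c + b * d"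
  by (simp add: inner_vec_def sum_2)

lemma norm_vector2: "norm (vector [a, b] :: real^2) = sqrt (a\<^sup>2 + b\<^sup>2)"
  by (simp add: norm_eq_sqrt_inner inner_vector2 power2_eq_square)

lemma scaleR_vector2: "c *\<^sub>R (vector [a, b] :: real^2) = vector [c * a, c * b]"
  by (simp add: vec_eq_iff forall_2)

section \<open>Smoothness of rational functions of sine and cosine\<close>

text \<open>A class that contains a derivative of each of its members contains all iterated
  derivatives, so these never have to be computed.\<close>

lemma smooth_coinduct:
  assumes "F f"
    and closed: "\<And>f. F f \<Longrightarrow> \<exists>f'. F f' \<and> (\<forall>x. (f has_vector_derivative f' x) (at x))"
  shows "smooth f"
proof -
  have "F (((\<lambda>g t. vector_derivative g (at t)) ^^ n) f)" for n
  proof (induction n)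
    case (Suc n)
    let ?g = "((\<lambda>g t. vector_derivative g (at t)) ^^ n) f"
    obtain g' where g': "F g'" "\<And>x. (?g has_vector_derivative g' x) (at x)"
      using closed[OF Suc] by blast
    then have "(\<lambda>t. vector_derivative ?g (at t)) = g'"
      by (auto intro!: vector_derivative_at)
    with g'(1) show ?case by simp
  qed (simp add: assms(1))
  then show ?thesis
    unfolding smooth_def using closed differentiableI_vector by blast
qed

text \<open>A class closed under differentiation that is large enough for the coordinate functions
  of the curve. The side condition in \<open>inverse\<close> keeps its members differentiable
  everywhere.\<close>

inductive trig_rational :: "(real \<Rightarrow> real) \<Rightarrow> bool" where
  const: "trig_rational (\<lambda>x. c)"
| sin: "trig_rational (\<lambda>x. sin (2 * pi * x))"
| cos: "trig_rational (\<lambda>x. cos (2 * pi * x))"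
| add: "trig_rational f \<Longrightarrow> trig_rational g \<Longrightarrow> trig_rational (\<lambda>x. f x + g x)"
| mult: "trig_rational f \<Longrightarrow> trig_rational g \<Longrightarrow> trig_rational (\<lambda>x. f x * g x)"
| inverse: "trig_rational f \<Longrightarrow> (\<And>x. f x \<noteq> 0) \<Longrightarrow> trig_rational (\<lambda>x. inverse (f x))"

lemma trig_rational_minus: "trig_rational f \<Longrightarrow> trig_rational (\<lambda>x. - f x)"
  using trig_rational.mult[OF trig_rational.const[of "-1"]] by simp

lemma trig_rational_diff:
  "trig_rational f \<Longrightarrow> trig_rational g \<Longrightarrow> trig_rational (\<lambda>x. f x - g x)"
  using trig_rational.add[OF _ trig_rational_minus] by simp

lemma trig_rational_power: "trig_rational f \<Longrightarrow> trig_rational (\<lambda>x. f x ^ n)"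
  by (induction n) (auto intro: trig_rational.intros)

lemma trig_rational_derivative:
  "trig_rational f \<Longrightarrow> \<exists>f'. trig_rational f' \<and> (\<forall>x. (f has_real_derivative f' x) (at x))"
proof (induction rule: trig_rational.induct)
  case (const c)
  show ?case
    by (rule exI[of _ "\<lambda>x. 0"]) (auto intro: trig_rational.const)
next
  case sin
  show ?case
    by (rule exI[of _ "\<lambda>x. 2 * pi * cos (2 * pi * x)"])
      (auto intro!: trig_rational.intros derivative_eq_intros)
next
  case cos
  show ?case
    by (rule exI[of _ "\<lambda>x. - (2 * pi * sin (2 * pi * x))"])
      (auto intro!: trig_rational_minus trig_rational.mult trig_rational.const trig_rational.sin
        derivative_eq_intros)
next
  case (add f g)
  then obtain f' g' where
    "trig_rational f'" "\<And>x. (f has_real_derivative f' x) (at x)"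
    "trig_rational g'" "\<And>x. (g has_real_derivative g' x) (at x)" by blast
  then show ?case
    by (intro exI[of _ "\<lambda>x. f' x + g' x"]) (auto intro!: trig_rational.add derivative_intros)
next
  case (mult f g)
  then obtain f' g' where
    "trig_rational f'" "\<And>x. (f has_real_derivative f' x) (at x)"
    "trig_rational g'" "\<And>x. (g has_real_derivative g' x) (at x)" by blast
  with mult.hyps show ?case
    by (intro exI[of _ "\<lambda>x. f' x * g x + g' x * f x"])
      (auto intro!: trig_rational.add trig_rational.mult DERIV_mult)
next
  case (inverse f)
  then obtain f' where
    "trig_rational f'" "\<And>x. (f has_real_derivative f' x) (at x)" by blast
  with inverse.hyps show ?case
    by (intro exI[of _ "\<lambda>x. - (inverse (f x) * f' x * inverse (f x))"])
      (auto intro!: trig_rational_minus trig_rational.intros DERIV_inverse' simp: inverse.hyps)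
qed

lemma smooth_trig_rational_vector2:
  assumes "trig_rational f" "trig_rational g"
  shows "smooth (\<lambda>x. vector [f x, g x] :: real^2)"
proof (rule smooth_coinduct)
  let ?F = "\<lambda>h :: real \<Rightarrow> real^2.
    \<exists>f g. trig_rational f \<and> trig_rational g \<and> h = (\<lambda>x. vector [f x, g x])"
  show "?F (\<lambda>x. vector [f x, g x])"
    using assms by blast
  fix h
  assume "?F h"
  then obtain f g where h: "trig_rational f" "trig_rational g" "h = (\<lambda>x. vector [f x, g x])"
    by blast
  obtain f' g' where
    "trig_rational f'" "\<And>x. (f has_real_derivative f' x) (at x)"
    "trig_rational g'" "\<And>x. (g has_real_derivative g' x) (at x)"
    using h(1,2)[THEN trig_rational_derivative] by blast
  then show "\<exists>h'. ?F h' \<and> (\<forall>x. (h has_vector_derivative h' x) (at x))"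
    by (intro exI[of _ "\<lambda>x. vector [f' x, g' x]"])
      (auto simp: h(3) intro: has_vector_derivative_vector2)
qed

section \<open>Moving frame and elastic operator\<close>

text \<open>Here \<open>v\<close> is the constant speed, \<open>k\<close> the signed curvature, and
  \<open>k1\<close>, \<open>k2\<close> are its first two arc length derivatives. With the frame
  given as data, the elastic equation becomes a scalar identity.\<close>

locale frenet_curve =
  fixes \<gamma> :: "real \<Rightarrow> real^2" and v :: real and C S k k1 k2 :: "real \<Rightarrow> real"
  assumes speed: "v > 0"
    and deriv_curve: "\<And>x. (\<gamma> has_vector_derivative v *\<^sub>R vector [C x, S x]) (at x)"
    and unit: "\<And>x. (C x)\<^sup>2 + (S x)\<^sup>2 = 1"
    and deriv_C: "\<And>x. (C has_real_derivative - (v * k x * S x)) (at x)"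
    and deriv_S: "\<And>x. (S has_real_derivative v * k x * C x) (at x)"
    and deriv_k: "\<And>x. (k has_real_derivative v * k1 x) (at x)"
    and deriv_k1: "\<And>x. (k1 has_real_derivative v * k2 x) (at x)"
begin

abbreviation T :: "real \<Rightarrow> real^2" where "T x \<equiv> vector [C x, S x]"
abbreviation N :: "real \<Rightarrow> real^2" where "N x \<equiv> vector [- S x, C x]"

lemma arc_deriv_eq:
  assumes "(h has_vector_derivative v *\<^sub>R h') (at x)"
  shows "arc_deriv \<gamma> h x = h'"
  using vector_derivative_at[OF assms] vector_derivative_at[OF deriv_curve[of x]] speed unit[of x]
  by (simp add: arc_deriv_def norm_vector2)

lemma tangent_eq: "tangent \<gamma> = T"
  by (rule ext) (simp add: tangent_def arc_deriv_eq[OF deriv_curve])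

lemma unit_normal_eq: "unit_normal \<gamma> x = N x"
  by (simp add: unit_normal_def tangent_eq)

lemma deriv_T: "(T has_vector_derivative v *\<^sub>R (k x *\<^sub>R N x)) (at x)"
  using has_vector_derivative_vector2[OF deriv_C deriv_S, of x] by (simp add: scaleR_vector2 mult.assoc)

lemma deriv_N: "(N has_vector_derivative v *\<^sub>R (- k x *\<^sub>R T x)) (at x)"
  using has_vector_derivative_vector2[OF DERIV_minus[OF deriv_S] deriv_C, of x]
  by (simp add: scaleR_vector2 mult.assoc)

lemma curvature_eq: "curvature \<gamma> = (\<lambda>x. k x *\<^sub>R N x)"
  using tangent_eq by (auto simp: curvature_def tangent_def intro: arc_deriv_eq deriv_T)

lemma deriv_scaleR_N:
  assumes "(f has_real_derivative v * f') (at x)"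
  shows "((\<lambda>x. f x *\<^sub>R N x) has_vector_derivative v *\<^sub>R (f' *\<^sub>R N x - (f x * k x) *\<^sub>R T x)) (at x)"
  by (rule has_vector_derivative_eq_rhs
      [OF has_vector_derivative_scaleR[OF assms deriv_N]])
    (simp add: algebra_simps)

text \<open>By the Frenet equations the derivative of the normal is tangential, and the projection
  removes it. On multiples of \<open>N\<close>, normal differentiation is thus scalar
  differentiation.\<close>

lemma normal_deriv_scaleR_N:
  assumes "(f has_real_derivative v * f') (at x)"
  shows "normal_deriv \<gamma> (\<lambda>x. f x *\<^sub>R N x) x = f' *\<^sub>R N x"
proof -
  have "T x \<bullet> T x = 1" "N x \<bullet> T x = 0"
    using unit[of x] by (simp_all add: inner_vector2 power2_eq_square)
  then show ?thesis
    by (simp add: normal_deriv_def arc_deriv_eq[OF deriv_scaleR_N[OF assms]] tangent_eq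
        inner_diff_left)
qed

lemma normal_deriv_curvature_eq: "normal_deriv \<gamma> (curvature \<gamma>) = (\<lambda>x. k1 x *\<^sub>R N x)"
  by (rule ext) (simp add: curvature_eq normal_deriv_scaleR_N deriv_k)

lemma elastic_operator_eq:
  "elastic_operator \<mu> \<gamma> x = (k2 x + (k x)^3 / 2 - \<mu> * k x) *\<^sub>R N x"
proof -
  have "norm (N x) = 1"
    using unit[of x] by (simp add: norm_vector2 add.commute)
  then show ?thesis
    by (simp add: elastic_operator_def normal_deriv_curvature_eq normal_deriv_scaleR_N[OF deriv_k1]
        curvature_eq[THEN fun_cong] algebra_simps power2_eq_square power3_eq_cube)
qed

lemma differentiable_fields:
  "\<gamma> differentiable at x" "tangent \<gamma> differentiable at x" "curvature \<gamma> differentiable at x"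
  "normal_deriv \<gamma> (curvature \<gamma>) differentiable at x"
  unfolding tangent_eq normal_deriv_curvature_eq unfolding curvature_eq
  using deriv_curve deriv_T deriv_scaleR_N[OF deriv_k] deriv_scaleR_N[OF deriv_k1]
  by (blast intro: differentiableI_vector)+

end

section \<open>Invariance under reparametrization\<close>

text \<open>Differentiability is assumed of the composite \<open>h\<close> only: \<open>f\<close>
  agrees with \<open>h \<circ> inv \<psi>\<close> on the range of \<open>\<psi>\<close>, which is
  open, and \<open>inv \<psi>\<close> is differentiable there. So nothing has to be known in advance
  about the fields along the covered curve.\<close>

lemma vector_derivative_compose_diffeo:
  fixes \<psi> \<psi>' :: "real \<Rightarrow> real" and f :: "real \<Rightarrow> 'a::real_normed_vector"
  assumes \<psi>: "\<And>x. (\<psi> has_real_derivative \<psi>' x) (at x)" and nz: "\<And>x. \<psi>' x \<noteq> 0"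
    and h: "h differentiable at x" and eq: "\<And>x. h x = f (\<psi> x)"
  shows "vector_derivative h (at x) = \<psi>' x *\<^sub>R vector_derivative f (at (\<psi> x))"
proof -
  have cont: "continuous_on UNIV \<psi>"
    using \<psi> by (auto intro!: continuous_at_imp_continuous_on DERIV_isCont)
  have neq: "\<psi> a \<noteq> \<psi> b" if "a < b" for a b
    using MVT2[OF that, of \<psi> \<psi>'] \<psi> nz that by (metis diff_gt_0_iff_gt eq_iff_diff_eq_0 mult_eq_0_iff less_irrefl)
  have inj: "inj \<psi>"
    by (rule injI) (metis neq linorder_neqE)
  have "open (range \<psi>)"
    using injective_eq_1d_open_map_UNIV[of UNIV \<psi>] cont inj by auto
  have inv: "(inv \<psi> has_real_derivative inverse (\<psi>' x)) (at (\<psi> x))"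
    unfolding has_field_derivative_def
    by (rule has_derivative_inverse_strong[of UNIV x \<psi> _ "(*) (\<psi>' x)"])
      (use cont inj \<psi>[of x] nz[of x] in \<open>auto simp: has_field_derivative_def o_def fun_eq_iff\<close>)
  have "(h has_vector_derivative vector_derivative h (at x)) (at (inv \<psi> (\<psi> x)))"
    using h inj by (simp add: vector_derivative_works)
  from vector_diff_chain_at[OF inv[unfolded has_real_derivative_iff_has_vector_derivative] this]
  have "((h \<circ> inv \<psi>) has_vector_derivative inverse (\<psi>' x) *\<^sub>R vector_derivative h (at x)) (at (\<psi> x))" .
  then have "(f has_vector_derivative inverse (\<psi>' x) *\<^sub>R vector_derivative h (at x)) (at (\<psi> x))"
    by (rule has_vector_derivative_transform_within_open[OF _ \<open>open (range \<psi>)\<close>])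
      (auto simp: eq f_inv_into_f)
  then show ?thesis
    using nz[of x] by (simp add: vector_derivative_at)
qed

lemma constant_sign:
  fixes f :: "real \<Rightarrow> real"
  assumes "continuous_on UNIV f" "\<And>x. f x \<noteq> 0"
  shows "sgn (f x) = sgn (f y)"
proof (rule ccontr)
  assume neq: "sgn (f x) \<noteq> sgn (f y)"
  have "connected (range f)"
    by (rule connected_continuous_image[OF assms(1)]) simp
  moreover have "f x < 0 \<and> 0 < f y \<or> f y < 0 \<and> 0 < f x"
    using neq assms(2)[of x] assms(2)[of y] by (auto simp: sgn_if split: if_splits)
  ultimately have "0 \<in> range f"
    by (meson connectedD_interval less_imp_le rangeI)
  with assms(2) show False by auto
qed

text \<open>Each arc length derivative contributes the sign of the orientation. The curvature takes
  two derivatives and its second normal derivative two more, so the signs cancel even if the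
  orientation is reversed.\<close>

lemma elastic_operator_fold_cover:
  assumes cover: "fold_cover m \<eta> \<gamma>" and "1 \<le> m"
    and diff: "\<And>x. \<gamma> differentiable at x" "\<And>x. tangent \<gamma> differentiable at x"
      "\<And>x. curvature \<gamma> differentiable at x"
      "\<And>x. normal_deriv \<gamma> (curvature \<gamma>) differentiable at x"
  shows "\<exists>\<psi>. \<forall>x. elastic_operator \<mu> \<gamma> x = elastic_operator \<mu> \<eta> (\<psi> x)"
proof -
  obtain \<phi> where \<phi>: "smooth \<phi>" "\<And>x. vector_derivative \<phi> (at x) \<noteq> 0"
      "\<And>x. \<gamma> x = \<eta> (real m * \<phi> x)"
    using cover by (auto simp: fold_cover_def circle_reparametrization_def)
  have d0: "\<phi> differentiable at x" and d1: "(\<lambda>t. vector_derivative \<phi> (at t)) differentiable at x" for x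
    using \<phi>(1) unfolding smooth_def by (metis funpow_0, metis funpow_0 funpow.simps(2) comp_apply)
  define \<psi> where "\<psi> x = real m * \<phi> x" for x
  define \<psi>' where "\<psi>' x = real m * vector_derivative \<phi> (at x)" for x
  have \<psi>: "(\<psi> has_real_derivative \<psi>' x) (at x)" for x
    unfolding \<psi>_def \<psi>'_def using d0[of x]
    by (intro DERIV_cmult)
      (simp add: vector_derivative_works has_real_derivative_iff_has_vector_derivative)
  have nz: "\<psi>' x \<noteq> 0" for x
    using \<phi>(2) \<open>1 \<le> m\<close> by (simp add: \<psi>'_def)
  have "continuous_on UNIV \<psi>'"
    unfolding \<psi>'_def using d1
    by (intro continuous_intros continuous_at_imp_continuous_on)
      (auto intro: differentiable_imp_continuous_within)
  \<comment> \<open>The orientation of \<open>\<psi>\<close>; it does not depend on the point, since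
    \<open>\<psi>'\<close> is continuous without zeros.\<close>
  define \<epsilon> where "\<epsilon> = sgn (\<psi>' 0)"
  have sgn: "\<psi>' x = \<epsilon> * \<bar>\<psi>' x\<bar>" for x
    using constant_sign[OF \<open>continuous_on UNIV \<psi>'\<close> nz, of 0 x] unfolding \<epsilon>_def
    by (metis sgn_mult_abs)
  have \<epsilon>2: "\<epsilon> * \<epsilon> = 1"
    using nz[of 0] by (simp add: \<epsilon>_def sgn_if)
  have arc: "arc_deriv \<gamma> h x = \<epsilon> *\<^sub>R arc_deriv \<eta> f (\<psi> x)"
    if "h differentiable at x" "\<And>x. h x = f (\<psi> x)" for h f x
  proof -
    have \<gamma>': "vector_derivative \<gamma> (at x) = \<psi>' x *\<^sub>R vector_derivative \<eta> (at (\<psi> x))"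
      by (rule vector_derivative_compose_diffeo[OF \<psi> nz diff(1)]) (simp add: \<phi>(3) \<psi>_def)
    have h': "vector_derivative h (at x) = \<psi>' x *\<^sub>R vector_derivative f (at (\<psi> x))"
      by (rule vector_derivative_compose_diffeo[OF \<psi> nz that])
    have "\<psi>' x / \<bar>\<psi>' x\<bar> = \<epsilon>"
      using sgn[of x] nz[of x] by (metis abs_0_eq nonzero_mult_div_cancel_right)
    then show ?thesis
      by (simp add: arc_deriv_def \<gamma>' h' divide_inverse mult_ac)
  qed
  have arc_scale: "arc_deriv \<gamma> (\<lambda>x. \<epsilon> *\<^sub>R h x) x = \<epsilon> *\<^sub>R arc_deriv \<gamma> h x"
    if "h differentiable at x" for h x
    using that unfolding arc_deriv_def
    by (simp add: vector_derivative_scaleR_at)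
  have scale_diff: "(\<lambda>x. \<epsilon> *\<^sub>R h x) differentiable at x"
    if "h differentiable at x" for h :: "real \<Rightarrow> real^2" and x
    by (intro derivative_intros that)
  have tan: "tangent \<gamma> x = \<epsilon> *\<^sub>R tangent \<eta> (\<psi> x)" for x
    unfolding tangent_def by (rule arc) (simp_all add: diff \<phi>(3) \<psi>_def)
  have curv: "curvature \<gamma> x = curvature \<eta> (\<psi> x)" for x
  proof -
    \<comment> \<open>As \<open>\<epsilon> * \<epsilon> = 1\<close>, it is \<open>\<epsilon>\<close>
      times the tangent of \<open>\<gamma>\<close> that is the pullback of the tangent of
      \<open>\<eta>\<close>, as \<open>arc\<close> demands. The same device serves for the second
      normal derivative.\<close>
    have "arc_deriv \<gamma> (\<lambda>x. \<epsilon> *\<^sub>R tangent \<gamma> x) x = \<epsilon> *\<^sub>R arc_deriv \<eta> (tangent \<eta>) (\<psi> x)"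
      by (rule arc[OF scale_diff[OF diff(2)]]) (simp add: tan \<epsilon>2)
    then show ?thesis
      using arc_scale[OF diff(2)] \<epsilon>2 by (auto simp: curvature_def tangent_def)
  qed
  have normal: "normal_deriv \<gamma> h x = \<epsilon> *\<^sub>R normal_deriv \<eta> f (\<psi> x)"
    if "h differentiable at x" "\<And>x. h x = f (\<psi> x)" for h f x
    using \<epsilon>2 by (simp add: normal_deriv_def arc[OF that] tan scaleR_diff_right mult.commute mult.left_commute)
  have nd1: "normal_deriv \<gamma> (curvature \<gamma>) x = \<epsilon> *\<^sub>R normal_deriv \<eta> (curvature \<eta>) (\<psi> x)" for x
    by (rule normal) (simp_all add: diff curv)
  have nd2: "normal_deriv \<gamma> (normal_deriv \<gamma> (curvature \<gamma>)) x
      = normal_deriv \<eta> (normal_deriv \<eta> (curvature \<eta>)) (\<psi> x)" for x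
  proof -
    let ?h = "normal_deriv \<gamma> (curvature \<gamma>)"
    have "normal_deriv \<gamma> (\<lambda>x. \<epsilon> *\<^sub>R ?h x) x
        = \<epsilon> *\<^sub>R normal_deriv \<eta> (normal_deriv \<eta> (curvature \<eta>)) (\<psi> x)"
      by (rule normal[OF scale_diff[OF diff(4)]]) (simp add: nd1 \<epsilon>2)
    moreover have "normal_deriv \<gamma> (\<lambda>x. \<epsilon> *\<^sub>R ?h x) x = \<epsilon> *\<^sub>R normal_deriv \<gamma> ?h x"
      using arc_scale[OF diff(4)] by (simp add: normal_deriv_def scaleR_diff_right)
    ultimately show ?thesis
      using \<epsilon>2 by auto
  qed
  have "elastic_operator \<mu> \<gamma> x = elastic_operator \<mu> \<eta> (\<psi> x)" for x
    by (simp add: elastic_operator_def nd2 curv)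
  then show ?thesis by blast
qed

section \<open>Covers of circles and figure eights\<close>

text \<open>For the constant curvature \<open>k = 1 / r\<close> the equation reduces to
  \<open>k^3 / 2 = \<mu> * k\<close>, which determines \<open>\<mu>\<close>.\<close>

lemma circle_elastic_operator:
  assumes "r > 0"
  shows "elastic_operator (1 / (2 * r\<^sup>2)) (circle_curve p r) x = 0"
proof -
  interpret frenet_curve "circle_curve p r" "2 * pi * r" "\<lambda>x. - sin (2 * pi * x)"
    "\<lambda>x. cos (2 * pi * x)" "\<lambda>x. 1 / r" "\<lambda>x. 0" "\<lambda>x. 0"
  proof
    fix x
    have "((\<lambda>x. vector [cos (2 * pi * x), sin (2 * pi * x)] :: real^2) has_vector_derivative
        vector [- (2 * pi) * sin (2 * pi * x), (2 * pi) * cos (2 * pi * x)]) (at x)"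
      by (rule has_vector_derivative_vector2) (auto intro!: derivative_eq_intros)
    from has_vector_derivative_add[OF has_vector_derivative_const[of p]
        has_vector_derivative_scaleR[OF DERIV_const[of r] this]]
    show "(circle_curve p r has_vector_derivative
        (2 * pi * r) *\<^sub>R vector [- sin (2 * pi * x), cos (2 * pi * x)]) (at x)"
      unfolding circle_curve_def scaleR_vector2
      by (rule has_vector_derivative_eq_rhs) (simp add: scaleR_vector2 vector2_eq mult_ac)
  qed (use assms in \<open>auto intro!: derivative_eq_intros\<close>)
  show ?thesis
    using assms
    by (simp add: elastic_operator_eq field_simps power2_eq_square power3_eq_cube)
qed

lemma multifold_imp_elastica:
  assumes "multifold_circle \<gamma> \<or> multifold_figure_eight \<gamma>"
    and diff: "\<And>x. \<gamma> differentiable at x" "\<And>x. tangent \<gamma> differentiable at x"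
      "\<And>x. curvature \<gamma> differentiable at x"
      "\<And>x. normal_deriv \<gamma> (curvature \<gamma>) differentiable at x"
  shows "\<exists>\<mu>. \<forall>x. elastic_operator \<mu> \<gamma> x = 0"
proof -
  obtain m \<eta> \<mu> where "1 \<le> m" "fold_cover m \<eta> \<gamma>" "\<And>x. elastic_operator \<mu> \<eta> x = 0"
    using assms(1) circle_elastic_operator
    unfolding multifold_circle_def multifold_figure_eight_def figure_eight_elastica_def
      closed_elastica_def by metis
  then show ?thesis
    using elastic_operator_fold_cover[OF _ _ diff, of m \<eta> \<mu>] by metis
qed

section \<open>The explicit curve\<close>

theorem corollary6p9:
  fixes lam :: real
  assumes "lam > 0"
  shows "\<exists>(c\<^sub>1::real) \<gamma>. regular_closed_curve \<gamma>
           \<and> (\<forall>x. elastic_operator lam \<gamma> x = c\<^sub>1 *\<^sub>R unit_normal \<gamma> x)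
           \<and> \<not> multifold_circle \<gamma> \<and> \<not> multifold_figure_eight \<gamma>"
proof -
  define w where "w = sqrt (lam / 5)"
  have w: "w > 0" and lam: "lam = 5 * w\<^sup>2"
    using assms by (auto simp: w_def)
  \<comment> \<open>The mean of \<open>1 / (2 + q * cos \<phi>)\<close> over a period is
    \<open>1 / sqrt (4 - q^2)\<close>. It equals 1 for this \<open>q\<close>, so that
    \<open>r - 1\<close>, and with it \<open>k\<close>, has mean 0.\<close>
  define q :: real where "q = sqrt 3"
  have q: "q\<^sup>2 = 3" "0 < q" "q < 2"
    by (auto simp: q_def intro: real_less_lsqrt)
  define s c r where "s x = sin (2 * pi * x)" and "c x = cos (2 * pi * x)"
    and "r x = inverse (2 + q * c x)" for x :: real
  have pos: "2 + q * c x > 0" for x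
  proof -
    have "\<bar>q * c x\<bar> \<le> q * 1"
      unfolding abs_mult using q by (intro mult_mono) (auto simp: c_def)
    then show ?thesis using q by linarith
  qed
  have sc: "(s x)\<^sup>2 = 1 - (c x)\<^sup>2" for x
    by (simp add: s_def c_def sin_squared_eq)
  have rq: "r x * (2 + q * c x) = 1" for x
    using pos[of x] by (simp add: r_def)
  have ds: "(s has_real_derivative 2 * pi * c x) (at x)"
    and dc: "(c has_real_derivative - (2 * pi * s x)) (at x)" for x
    unfolding s_def c_def by (auto intro!: derivative_eq_intros)
  have dr: "(r has_real_derivative 2 * pi * (q * s x * (r x)\<^sup>2)) (at x)" for x
    unfolding r_def using pos[of x]
    by (auto intro!: derivative_eq_intros dc simp: power2_eq_square)
  \<comment> \<open>\<open>(A, B)\<close> is the point at half the tangent angle, that is at angle \<open>E - \<phi>\<close>, where \<open>E\<close> is the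
    eccentric anomaly belonging to the true anomaly \<open>\<phi>\<close> and the eccentricity \<open>q/2\<close>.\<close>
  define A B where "A x = r x * (q * c x + 1 + (c x)\<^sup>2)" and "B x = - (r x * s x * (q + c x))" for x
  define C S where "C x = (A x)\<^sup>2 - (B x)\<^sup>2" and "S x = 2 * A x * B x" for x
  \<comment> \<open>The tangential and normal components \<open>k'/c\<close> and \<open>(\<lambda> - k\<^sup>2/2)/c\<close> of \<open>\<gamma>\<close>.\<close>
  define a b where "a x = q * s x * (r x)\<^sup>2 / (3 * w)" and "b x = (5 - 2 * (r x - 1)\<^sup>2) / (6 * w)" for x
  define k k1 k2 where "k x = 2 * w * (r x - 1)" and "k1 x = 2 * w\<^sup>2 * (q * s x * (r x)\<^sup>2)"
    and "k2 x = 2 * w^3 * (- r x + 6 * (r x)\<^sup>2 - 2 * (r x)^3)" for x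
  define \<gamma> :: "real \<Rightarrow> real^2" where "\<gamma> x = vector [a x * C x - b x * S x, a x * S x + b x * C x]" for x
  have AB: "(A x)\<^sup>2 + (B x)\<^sup>2 = 1" for x
  proof -
    have "(A x)\<^sup>2 + (B x)\<^sup>2 = (r x * (2 + q * c x))\<^sup>2"
      unfolding A_def B_def using sc[of x] q(1) by algebra
    then show ?thesis by (simp add: rq)
  qed
  \<comment> \<open>The tangent angle changes at rate \<open>k / w = 2 * (r - 1)\<close> with
    respect to \<open>\<phi> = 2 * pi * x\<close>, so the point \<open>(A, B)\<close> at half that
    angle rotates at rate \<open>r - 1\<close>.\<close>
  have dA: "(A has_real_derivative 2 * pi * (- (r x - 1) * B x)) (at x)" for x
  proof -
    have "(A has_real_derivative 2 * pi * ((q * s x * (r x)\<^sup>2) * (q * c x + 1 + (c x)\<^sup>2)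
        + r x * (- q * s x - 2 * c x * s x))) (at x)"
      unfolding A_def by (auto intro!: derivative_eq_intros dr dc simp: algebra_simps)
    moreover have "(q * s x * (r x)\<^sup>2) * (q * c x + 1 + (c x)\<^sup>2) + r x * (- q * s x - 2 * c x * s x)
        = - (r x - 1) * B x"
      unfolding B_def using sc[of x] q(1) rq[of x] by algebra
    ultimately show ?thesis by simp
  qed
  have dB: "(B has_real_derivative 2 * pi * ((r x - 1) * A x)) (at x)" for x
  proof -
    have "(B has_real_derivative 2 * pi * (- ((q * s x * (r x)\<^sup>2) * s x * (q + c x)
        + r x * c x * (q + c x) - r x * (s x)\<^sup>2))) (at x)"
      unfolding B_def by (auto intro!: derivative_eq_intros dr dc ds simp: algebra_simps power2_eq_square)
    moreover have "- ((q * s x * (r x)\<^sup>2) * s x * (q + c x) + r x * c x * (q + c x) - r x * (s x)\<^sup>2)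
        = (r x - 1) * A x"
      unfolding A_def using sc[of x] q(1) rq[of x] by algebra
    ultimately show ?thesis by simp
  qed
  have dC: "(C has_real_derivative - (2 * pi * (2 * (r x - 1)) * S x)) (at x)" for x
    unfolding C_def S_def by (auto intro!: derivative_eq_intros dA dB simp: algebra_simps)
  have dS: "(S has_real_derivative 2 * pi * (2 * (r x - 1)) * C x) (at x)" for x
    unfolding C_def S_def
    by (auto intro!: derivative_eq_intros dA dB simp: algebra_simps power2_eq_square)
  have dr2: "((\<lambda>x. q * s x * (r x)\<^sup>2) has_real_derivative
      2 * pi * (- r x + 6 * (r x)\<^sup>2 - 2 * (r x)^3)) (at x)" for x
  proof -
    have "((\<lambda>x. q * s x * (r x)\<^sup>2) has_real_derivative
        2 * pi * (q * c x * (r x)\<^sup>2 + 2 * (q * s x)\<^sup>2 * (r x)^3)) (at x)"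
      by (auto intro!: derivative_eq_intros ds dr simp: algebra_simps power2_eq_square power3_eq_cube)
    \<comment> \<open>By \<open>rq\<close>, \<open>q * c x\<close> is \<open>1 / r x - 2\<close>.
      Hence \<open>(q * s x)^2 = 3 - (q * c x)^2\<close> is a polynomial in \<open>1 / r x\<close>,
      and the cosine is eliminated.\<close>
    moreover have "q * c x * (r x)\<^sup>2 + 2 * (q * s x)\<^sup>2 * (r x)^3 = - r x + 6 * (r x)\<^sup>2 - 2 * (r x)^3"
      using sc[of x] q(1) rq[of x] by algebra
    ultimately show ?thesis by simp
  qed
  have da: "(a has_real_derivative 2 * pi * ((- r x + 6 * (r x)\<^sup>2 - 2 * (r x)^3) / (3 * w))) (at x)" for x
    using DERIV_cdivide[OF dr2, of "3 * w" x] unfolding a_def by simp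
  have db: "(b has_real_derivative 2 * pi * (- (2 * (r x - 1) * (q * s x * (r x)\<^sup>2)) / (3 * w))) (at x)" for x
    unfolding b_def using w by (auto intro!: derivative_eq_intros dr simp: field_simps)
  \<comment> \<open>The unit interval is one period of \<open>\<phi>\<close>, and arc length is
    \<open>\<phi> / w\<close>; this gives the speed.\<close>
  interpret frenet_curve \<gamma> "2 * pi / w" C S k k1 k2
  proof
    show "2 * pi / w > 0" using w by simp
    show "(C x)\<^sup>2 + (S x)\<^sup>2 = 1" for x
      unfolding C_def S_def using AB[of x] by algebra
    show "(C has_real_derivative - (2 * pi / w * k x * S x)) (at x)"
      "(S has_real_derivative 2 * pi / w * k x * C x) (at x)" for x
      using dC[of x] dS[of x] w by (simp_all add: k_def algebra_simps)
    show "(k has_real_derivative 2 * pi / w * k1 x) (at x)" for x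
      unfolding k_def k1_def using w
      by (auto intro!: derivative_eq_intros dr simp: field_simps power2_eq_square)
    show "(k1 has_real_derivative 2 * pi / w * k2 x) (at x)" for x
      unfolding k1_def k2_def
      by (rule DERIV_cmult[OF dr2, THEN DERIV_cong])
        (use w in \<open>simp add: field_simps power2_eq_square power3_eq_cube\<close>)
    show "(\<gamma> has_vector_derivative (2 * pi / w) *\<^sub>R vector [C x, S x]) (at x)" for x
    proof -
      let ?a' = "(- r x + 6 * (r x)\<^sup>2 - 2 * (r x)^3) / (3 * w)"
      let ?b' = "- (2 * (r x - 1) * (q * s x * (r x)\<^sup>2)) / (3 * w)"
      let ?t' = "2 * (r x - 1)"
      \<comment> \<open>The tangential and normal components of the derivative of
        \<open>a T + b N\<close> with respect to \<open>\<phi>\<close>, where \<open>?t'\<close> is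
        the rate of the tangent angle. They must equal those of \<open>T / w\<close>.\<close>
      have e1: "?a' - b x * ?t' = 1 / w" and e2: "?b' + a x * ?t' = 0"
        unfolding a_def b_def using w
        by (simp_all add: field_simps power2_eq_square power3_eq_cube)
      have "((\<lambda>x. a x * C x - b x * S x) has_real_derivative
          2 * pi * ((?a' - b x * ?t') * C x - (?b' + a x * ?t') * S x)) (at x)"
        by (rule DERIV_diff[OF DERIV_mult[OF da dC] DERIV_mult[OF db dS], THEN DERIV_cong])
          (simp add: algebra_simps)
      moreover have "((\<lambda>x. a x * S x + b x * C x) has_real_derivative
          2 * pi * ((?a' - b x * ?t') * S x + (?b' + a x * ?t') * C x)) (at x)"
        by (rule DERIV_add[OF DERIV_mult[OF da dS] DERIV_mult[OF db dC], THEN DERIV_cong])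
          (simp add: algebra_simps)
      ultimately show ?thesis
        unfolding \<gamma>_def e1 e2 scaleR_vector2
        by (auto intro!: has_vector_derivative_vector2)
    qed
  qed
  have tr: "trig_rational s" "trig_rational c" "trig_rational r"
    unfolding s_def c_def r_def
    using pos by (auto intro!: trig_rational.intros simp: c_def less_imp_neq[THEN not_sym])
  have "trig_rational A" "trig_rational B"
    unfolding A_def B_def
    by (intro tr trig_rational.add trig_rational.mult trig_rational.const trig_rational_minus trig_rational_power)+
  then have "trig_rational C" "trig_rational S"
    unfolding C_def S_def
    by (simp_all add: trig_rational.mult trig_rational.const trig_rational_diff trig_rational_power)
  moreover have "trig_rational a" "trig_rational b"
    unfolding a_def b_def divide_inverse
    by (intro tr trig_rational.mult trig_rational.const trig_rational_diff trig_rational_power)+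
  ultimately have "smooth \<gamma>"
    unfolding \<gamma>_def
    by (intro smooth_trig_rational_vector2 trig_rational.mult trig_rational.add trig_rational_diff)
  moreover have "\<gamma> (x + 1) = \<gamma> x" for x
  proof -
    have "s (x + 1) = s x" "c (x + 1) = c x"
      by (simp_all add: s_def c_def distrib_left)
    then show ?thesis
      by (simp add: \<gamma>_def a_def b_def C_def S_def A_def B_def r_def)
  qed
  moreover have "vector_derivative \<gamma> (at x) \<noteq> 0" for x
  proof -
    have "norm (vector_derivative \<gamma> (at x)) = 2 * pi / w"
      using vector_derivative_at[OF deriv_curve[of x]] unit[of x] w by (simp add: norm_vector2)
    then show ?thesis
      using w by auto
  qed
  ultimately have "regular_closed_curve \<gamma>"
    by (simp add: regular_closed_curve_def)
  moreover have ode: "k2 x + (k x)^3 / 2 = lam * k x + 6 * w^3" for x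
    unfolding k2_def k_def lam by (simp add: field_simps power2_eq_square power3_eq_cube)
  then have "elastic_operator lam \<gamma> x = (6 * w^3) *\<^sub>R unit_normal \<gamma> x" for x
    by (simp add: elastic_operator_eq unit_normal_eq)
  moreover have "\<not> (multifold_circle \<gamma> \<or> multifold_figure_eight \<gamma>)"
  proof
    assume "multifold_circle \<gamma> \<or> multifold_figure_eight \<gamma>"
    then obtain \<mu> where \<mu>: "\<And>x. elastic_operator \<mu> \<gamma> x = 0"
      using multifold_imp_elastica differentiable_fields by blast
    have *: "(\<mu> - lam) * k x = 6 * w^3" for x
    proof -
      have "N x \<noteq> 0"
        using unit[of x] by (auto simp: vec_eq_iff forall_2)
      then have "k2 x + (k x)^3 / 2 - \<mu> * k x = 0"
        using \<mu>[of x] by (simp add: elastic_operator_eq)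
      then show ?thesis
        using ode[of x] by (simp add: algebra_simps)
    qed
    have "k 0 \<noteq> k (1/4)"
      using w q(2) by (simp add: k_def r_def c_def field_simps)
    \<comment> \<open>Two different values of \<open>k\<close> force \<open>\<mu> = lam\<close>, and
      then \<open>6 * w^3 = 0\<close>.\<close>
    with *[of 0] *[of "1/4"] w show False
      by (metis mult_left_cancel mult_zero_left power_not_zero mult_eq_0_iff less_irrefl zero_neq_numeral)
  qed
  ultimately show ?thesis
    by blast
qed

end
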